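(* Let $\mathcal{P}=\{\mathbf{P}_i\}_{i\in\mathcal{I}}$ be a parameterized program with universal structure $\mathbb{T}$, equipped with the extended semantics on $\mathbb{T}$. Suppose the Hoare triple $\{\phi[\mu(u_1),\dots,\mu(u_m)]\}\,\langle\sigma_1:v_1\rangle\cdots\langle\sigma_n:v_n\rangle\,\{\psi[\mu(w_1),\dots,\mu(w_p)]\}$ (with all $u_j,v_j,w_j\in\mathbb{T}$) is valid, and let $\vec u',\vec v',\vec w'$ be tuples over $\mathbb{T}$ with $|\vec u'|=m$, $|\vec v'|=n$, $|\vec w'|=p$ and $\vec u\vec v\vec w\simeq\vec u'\vec v'\vec w'$. Then $\{\phi[\mu(u'_1),\dots,\mu(u'_m)]\}\,\langle\sigma_1:v'_1\rangle\cdots\langle\sigma_n:v'_n\rangle\,\{\psi[\mu(w'_1),\dots,\mu(w'_p)]\}$ is valid. (That is, the rule S-param is sound.)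
   Context: A vocabulary consists of predicate and function symbols (constants are nullary); equality is logical. For a structure and a set $V$ of elements, $N(V)$ is the substructure generated by $V$; $N(\vec a)$ is that of the set of entries of a tuple $\vec a$; juxtaposition of tuples denotes concatenation. For structures over the same vocabulary and tuples $\vec a,\vec b$ of the same length, a local isomorphism from $\vec a$ to $\vec b$ is an isomorphism $\beta:N(\vec a)\to N(\vec b)$ with $\beta(\vec a)=\vec b$; $\vec a\simeq\vec b$ if one exists. Programs. Fix a vocabulary $\mathcal{V}_{\mathsf{Node}}$, a data domain $\mathbb{D}$ (a structure over a vocabulary $\mathcal{V}_{\mathsf{Data}}$), a finite set $\Sigma$ of commands, a finite set $\mathbf{L}$ of locations with distinguished $l_{\mathrm{init}},l_{\mathrm{err}}$, and maps $\mathsf{src},\mathsf{tgt}:\Sigma\to\mathbf{L}$. A topology is a $\mathcal{V}_{\mathsf{Node}}$-structure $\mathbb{T}$ (elements are nodes). A program over $\mathbb{T}$ is $\mathbf{P}=(P,[\![-]\!])$ with $P:\mathbb{T}\to2^\Sigma$ and, for each $\langle\sigma:v\rangle\in\Sigma\times\mathbb{T}$, a relation $[\![\sigma:v]\!]\subseteq(N(v)\to\mathbb{D})^2$. For a set of nodes $V\supseteq N(v)$, $\mathsf{Global}_V[\![\sigma:v]\!]$ is the set of pairs $(\nu,\nu')$ of valuations $V\to\mathbb{D}$ with $(\nu|_{N(v)},\nu'|_{N(v)})\in[\![\sigma:v]\!]$ and $\nu,\nu'$ equal outside $N(v)$; this extends to words over $\Sigma\times\mathbb{T}$ whose nodes'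 neighbourhoods lie in $V$ by relational composition. For a local isomorphism $\beta:N(\vec a)\to N(\vec b)$, $\beta^*$ maps a valuation $\nu$ on $N(\vec b)$ to $\nu\circ\beta$, lifted componentwise to pairs and sets of pairs. A parameterized program is a family $\{\mathbf{P}_i\}_{i\in\mathcal{I}}$ of programs $\mathbf{P}_i=(P_i,[\![-]\!]_i)$ over topologies $\mathbb{T}_i$ (same $\mathcal{V}_{\mathsf{Node}},\mathbb{D},\Sigma,\mathbf{L}$) such that for all $i,j$, $a\in\mathbb{T}_i$, $a'\in\mathbb{T}_j$ and local isomorphism $\beta$ from $a$ to $a'$: $P_i(a)=P_j(a')$ and $[\![\sigma:a]\!]_i=\beta^*[\![\sigma:a']\!]_j$ for all $\sigma$. A universal structure for it is a $\mathcal{V}_{\mathsf{Node}}$-structure $\mathbb{T}$ into which every $\mathbb{T}_i$ embeds; each $\mathbb{T}_i$ is identified with a substructure of $\mathbb{T}$. The extended semantics on $\mathbb{T}$: for $v\in\mathbb{T}$, $[\![\sigma:v]\!]=\beta^*[\![\sigma:u]\!]_i$ if there are $i$, $u\in\mathbb{T}_i$ and a local isomorphism $\beta$ from $v$ to $u$, and $[\![\sigma:v]\!]=\emptyset$ otherwise. An assertion is $\phi[\mu(u_1),\dots,\mu(u_m)]$ with $\phi[x_1,\dots,x_m]$ a $\mathcal{V}_{\mathsf{Data}}$-formula, $u_j\in\mathbb{T}$, $\mu$ a formal unary symbol; a valuation $\nu$ defined on the $u_j$ satisfies it if $\mathbb{D}\models\phi[\nu(u_1),\dots,\nu(u_m)]$.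 A Hoare triple $\{\phi[\overrightarrow{\mu(u)}]\}\,\rho\,\{\psi[\overrightarrow{\mu(w)}]\}$ with $\rho=\langle\sigma_1:v_1\rangle\cdots\langle\sigma_n:v_n\rangle$ is valid if, for $V=N(\vec u\vec v\vec w)$, every $(\nu,\nu')\in\mathsf{Global}_V[\![\rho]\!]$ with $\nu$ satisfying the precondition has $\nu'$ satisfying the postcondition. *)

theory Defs
  imports Main "HOL-Library.FuncSet"
begin

record ('f, 'p) vocabulary =
  funs :: "'f set"
  preds :: "'p set"
  farity :: "'f \<Rightarrow> nat"
  parity :: "'p \<Rightarrow> nat"

record ('a, 'f, 'p) fo_struct =
  universe :: "'a set"
  fint :: "'f \<Rightarrow> 'a list \<Rightarrow> 'a"
  pint :: "'p \<Rightarrow> 'a list \<Rightarrow> bool"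

text \<open>The universe may be empty: the substructure generated by an empty tuple is
  empty whenever the vocabulary has no constants.\<close>

definition structure_over :: "('f, 'p) vocabulary \<Rightarrow> ('a, 'f, 'p) fo_struct \<Rightarrow> bool" where
  "structure_over Voc S \<longleftrightarrow>
     (\<forall>f \<in> funs Voc. \<forall>xs \<in> lists (universe S).
        length xs = farity Voc f \<longrightarrow> fint S f xs \<in> universe S)"

definition embedding ::
  "('f, 'p) vocabulary \<Rightarrow> ('a, 'f, 'p) fo_struct \<Rightarrow> ('b, 'f, 'p) fo_struct \<Rightarrow> ('a \<Rightarrow> 'b) \<Rightarrow> bool" where
  "embedding Voc A B h \<longleftrightarrow>
     h \<in> universe A \<rightarrow> universe B \<and> inj_on h (universe A) \<and>
     (\<forall>f \<in> funs Voc. \<forall>xs \<in> lists (universe A).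
        length xs = farity Voc f \<longrightarrow> h (fint A f xs) = fint B f (map h xs)) \<and>
     (\<forall>p \<in> preds Voc. \<forall>xs \<in> lists (universe A).
        length xs = parity Voc p \<longrightarrow> (pint A p xs \<longleftrightarrow> pint B p (map h xs)))"

definition isomorphism ::
  "('f, 'p) vocabulary \<Rightarrow> ('a, 'f, 'p) fo_struct \<Rightarrow> ('b, 'f, 'p) fo_struct \<Rightarrow> ('a \<Rightarrow> 'b) \<Rightarrow> bool" where
  "isomorphism Voc A B h \<longleftrightarrow> embedding Voc A B h \<and> h ` universe A = universe B"

inductive_set gen :: "('f, 'p) vocabulary \<Rightarrow> ('a, 'f, 'p) fo_struct \<Rightarrow> 'a set \<Rightarrow> 'a set"
  for Voc :: "('f, 'p) vocabulary" and S :: "('a, 'f, 'p) fo_struct" and V :: "'a set" where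
  base: "x \<in> V \<Longrightarrow> x \<in> gen Voc S V"
| step: "\<lbrakk>f \<in> funs Voc; xs \<in> lists (gen Voc S V); length xs = farity Voc f\<rbrakk>
           \<Longrightarrow> fint S f xs \<in> gen Voc S V"

definition gen_substruct ::
  "('f, 'p) vocabulary \<Rightarrow> ('a, 'f, 'p) fo_struct \<Rightarrow> 'a set \<Rightarrow> ('a, 'f, 'p) fo_struct" where
  "gen_substruct Voc S V = S\<lparr>universe := gen Voc S V\<rparr>"

definition local_iso ::
  "('f, 'p) vocabulary \<Rightarrow> ('a, 'f, 'p) fo_struct \<Rightarrow> 'a list \<Rightarrow> ('b, 'f, 'p) fo_struct \<Rightarrow> 'b list
     \<Rightarrow> ('a \<Rightarrow> 'b) \<Rightarrow> bool" where
  "local_iso Voc A as B bs \<beta> \<longleftrightarrow>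
     isomorphism Voc (gen_substruct Voc A (set as)) (gen_substruct Voc B (set bs)) \<beta> \<and>
     map \<beta> as = bs"

definition locally_isomorphic ::
  "('f, 'p) vocabulary \<Rightarrow> ('a, 'f, 'p) fo_struct \<Rightarrow> 'a list \<Rightarrow> ('b, 'f, 'p) fo_struct \<Rightarrow> 'b list
     \<Rightarrow> bool" where
  "locally_isomorphic Voc A as B bs \<longleftrightarrow> (\<exists>\<beta>. local_iso Voc A as B bs \<beta>)"

datatype 'f trm = Var nat | Fn 'f "'f trm list"

datatype ('f, 'p) fm =
    Falsum
  | Equ "'f trm" "'f trm"
  | Rel 'p "'f trm list"
  | Neg "('f, 'p) fm"
  | Conj "('f, 'p) fm" "('f, 'p) fm"
  | Disj "('f, 'p) fm" "('f, 'p) fm"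
  | Impl "('f, 'p) fm" "('f, 'p) fm"
  | All nat "('f, 'p) fm"
  | Exi nat "('f, 'p) fm"

primrec wf_trm :: "('f, 'p) vocabulary \<Rightarrow> 'f trm \<Rightarrow> bool" where
  "wf_trm Voc (Var x) \<longleftrightarrow> True"
| "wf_trm Voc (Fn f ts) \<longleftrightarrow>
     f \<in> funs Voc \<and> length ts = farity Voc f \<and> (\<forall>b \<in> set (map (wf_trm Voc) ts). b)"

primrec wf_fm :: "('f, 'p) vocabulary \<Rightarrow> ('f, 'p) fm \<Rightarrow> bool" where
  "wf_fm Voc Falsum \<longleftrightarrow> True"
| "wf_fm Voc (Equ s t) \<longleftrightarrow> wf_trm Voc s \<and> wf_trm Voc t"
| "wf_fm Voc (Rel p ts) \<longleftrightarrow>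
     p \<in> preds Voc \<and> length ts = parity Voc p \<and> (\<forall>t \<in> set ts. wf_trm Voc t)"
| "wf_fm Voc (Neg \<phi>) \<longleftrightarrow> wf_fm Voc \<phi>"
| "wf_fm Voc (Conj \<phi> \<psi>) \<longleftrightarrow> wf_fm Voc \<phi> \<and> wf_fm Voc \<psi>"
| "wf_fm Voc (Disj \<phi> \<psi>) \<longleftrightarrow> wf_fm Voc \<phi> \<and> wf_fm Voc \<psi>"
| "wf_fm Voc (Impl \<phi> \<psi>) \<longleftrightarrow> wf_fm Voc \<phi> \<and> wf_fm Voc \<psi>"
| "wf_fm Voc (All x \<phi>) \<longleftrightarrow> wf_fm Voc \<phi>"
| "wf_fm Voc (Exi x \<phi>) \<longleftrightarrow> wf_fm Voc \<phi>"

primrec fv_trm :: "'f trm \<Rightarrow> nat set" where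
  "fv_trm (Var x) = {x}"
| "fv_trm (Fn f ts) = \<Union> (set (map fv_trm ts))"

primrec fv :: "('f, 'p) fm \<Rightarrow> nat set" where
  "fv Falsum = {}"
| "fv (Equ s t) = fv_trm s \<union> fv_trm t"
| "fv (Rel p ts) = (\<Union>t \<in> set ts. fv_trm t)"
| "fv (Neg \<phi>) = fv \<phi>"
| "fv (Conj \<phi> \<psi>) = fv \<phi> \<union> fv \<psi>"
| "fv (Disj \<phi> \<psi>) = fv \<phi> \<union> fv \<psi>"
| "fv (Impl \<phi> \<psi>) = fv \<phi> \<union> fv \<psi>"
| "fv (All x \<phi>) = fv \<phi> - {x}"
| "fv (Exi x \<phi>) = fv \<phi> - {x}"

primrec eval_trm :: "('a, 'f, 'p) fo_struct \<Rightarrow> (nat \<Rightarrow> 'a) \<Rightarrow> 'f trm \<Rightarrow> 'a" where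
  "eval_trm S e (Var x) = e x"
| "eval_trm S e (Fn f ts) = fint S f (map (eval_trm S e) ts)"

primrec sat :: "('a, 'f, 'p) fo_struct \<Rightarrow> (nat \<Rightarrow> 'a) \<Rightarrow> ('f, 'p) fm \<Rightarrow> bool" where
  "sat S e Falsum \<longleftrightarrow> False"
| "sat S e (Equ s t) \<longleftrightarrow> eval_trm S e s = eval_trm S e t"
| "sat S e (Rel p ts) \<longleftrightarrow> pint S p (map (eval_trm S e) ts)"
| "sat S e (Neg \<phi>) \<longleftrightarrow> \<not> sat S e \<phi>"
| "sat S e (Conj \<phi> \<psi>) \<longleftrightarrow> sat S e \<phi> \<and> sat S e \<psi>"
| "sat S e (Disj \<phi> \<psi>) \<longleftrightarrow> sat S e \<phi> \<or> sat S e \<psi>"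
| "sat S e (Impl \<phi> \<psi>) \<longleftrightarrow> (sat S e \<phi> \<longrightarrow> sat S e \<psi>)"
| "sat S e (All x \<phi>) \<longleftrightarrow> (\<forall>a \<in> universe S. sat S (e(x := a)) \<phi>)"
| "sat S e (Exi x \<phi>) \<longleftrightarrow> (\<exists>a \<in> universe S. sat S (e(x := a)) \<phi>)"

record ('f, 'p, 'g, 'q, 'd, 'c, 'l) setting =
  node_voc :: "('f, 'p) vocabulary"
  data_voc :: "('g, 'q) vocabulary"
  data :: "('d, 'g, 'q) fo_struct"
  commands :: "'c set"
  locations :: "'l set"
  l_init :: 'l
  l_err :: 'l
  src :: "'c \<Rightarrow> 'l"
  tgt :: "'c \<Rightarrow> 'l"

definition wf_setting :: "('f, 'p, 'g, 'q, 'd, 'c, 'l) setting \<Rightarrow> bool" where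
  "wf_setting E \<longleftrightarrow>
     structure_over (data_voc E) (data E) \<and>
     finite (commands E) \<and> finite (locations E) \<and>
     l_init E \<in> locations E \<and> l_err E \<in> locations E \<and>
     src E \<in> commands E \<rightarrow> locations E \<and> tgt E \<in> commands E \<rightarrow> locations E"

text \<open>Valuations on a set of nodes are extensional functions, so that two valuations
  on \<open>V\<close> are equal as soon as they agree on \<open>V\<close>.\<close>

abbreviation valuations :: "('f, 'p, 'g, 'q, 'd, 'c, 'l) setting \<Rightarrow> 'n set \<Rightarrow> ('n \<Rightarrow> 'd) set" where
  "valuations E V \<equiv> V \<rightarrow>\<^sub>E universe (data E)"

type_synonym ('n, 'd) val_rel = "(('n \<Rightarrow> 'd) \<times> ('n \<Rightarrow> 'd)) set"

record ('n, 'f, 'p, 'd, 'c) program =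
  topology :: "('n, 'f, 'p) fo_struct"
  cmds_at :: "'n \<Rightarrow> 'c set"
  sem :: "'c \<Rightarrow> 'n \<Rightarrow> ('n, 'd) val_rel"

definition wf_program ::
  "('f, 'p, 'g, 'q, 'd, 'c, 'l) setting \<Rightarrow> ('n, 'f, 'p, 'd, 'c) program \<Rightarrow> bool" where
  "wf_program E P \<longleftrightarrow>
     structure_over (node_voc E) (topology P) \<and>
     (\<forall>v \<in> universe (topology P). cmds_at P v \<subseteq> commands E) \<and>
     (\<forall>\<sigma> \<in> commands E. \<forall>v \<in> universe (topology P).
        sem P \<sigma> v \<subseteq> valuations E (gen (node_voc E) (topology P) {v})
                     \<times> valuations E (gen (node_voc E) (topology P) {v}))"

text \<open>The map \<open>\<beta>\<^sup>*\<close> for \<open>\<beta>\<close> with domain \<open>A\<close>, on sets of pairs of valuations.\<close>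

definition pullback :: "'a set \<Rightarrow> ('a \<Rightarrow> 'b) \<Rightarrow> ('b, 'd) val_rel \<Rightarrow> ('a, 'd) val_rel" where
  "pullback A \<beta> R = map_prod (\<lambda>\<nu>. compose A \<nu> \<beta>) (\<lambda>\<nu>. compose A \<nu> \<beta>) ` R"

definition parameterized_program ::
  "('f, 'p, 'g, 'q, 'd, 'c, 'l) setting \<Rightarrow> 'i set \<Rightarrow> ('i \<Rightarrow> ('n, 'f, 'p, 'd, 'c) program) \<Rightarrow> bool" where
  "parameterized_program E I \<P> \<longleftrightarrow>
     (\<forall>i \<in> I. wf_program E (\<P> i)) \<and>
     (\<forall>i \<in> I. \<forall>j \<in> I. \<forall>a \<in> universe (topology (\<P> i)). \<forall>a' \<in> universe (topology (\<P> j)). \<forall>\<beta>.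
        local_iso (node_voc E) (topology (\<P> i)) [a] (topology (\<P> j)) [a'] \<beta> \<longrightarrow>
        cmds_at (\<P> i) a = cmds_at (\<P> j) a' \<and>
        (\<forall>\<sigma> \<in> commands E.
           sem (\<P> i) \<sigma> a =
             pullback (gen (node_voc E) (topology (\<P> i)) {a}) \<beta> (sem (\<P> j) \<sigma> a')))"

definition universal_structure ::
  "('f, 'p, 'g, 'q, 'd, 'c, 'l) setting \<Rightarrow> 'i set \<Rightarrow> ('i \<Rightarrow> ('n, 'f, 'p, 'd, 'c) program)
     \<Rightarrow> ('t, 'f, 'p) fo_struct \<Rightarrow> bool" where
  "universal_structure E I \<P> T \<longleftrightarrow>
     structure_over (node_voc E) T \<and>
     (\<forall>i \<in> I. \<exists>e. embedding (node_voc E) (topology (\<P> i)) T e)"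

text \<open>The extended semantics. The relation \<open>\<beta>\<^sup>*[\<sigma> : u]\<^sub>i\<close> does not depend on the choice of
  \<open>i\<close>, \<open>u\<close> and \<open>\<beta>\<close> (lemma \<open>ext_sem_eq\<close> below), so the description is proper.\<close>

definition ext_sem ::
  "('f, 'p, 'g, 'q, 'd, 'c, 'l) setting \<Rightarrow> 'i set \<Rightarrow> ('i \<Rightarrow> ('n, 'f, 'p, 'd, 'c) program)
     \<Rightarrow> ('t, 'f, 'p) fo_struct \<Rightarrow> 'c \<Rightarrow> 't \<Rightarrow> ('t, 'd) val_rel" where
  "ext_sem E I \<P> T \<sigma> v =
     (if \<exists>i \<in> I. \<exists>u \<in> universe (topology (\<P> i)). \<exists>\<beta>.
           local_iso (node_voc E) T [v] (topology (\<P> i)) [u] \<beta>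
      then (THE R. \<exists>i \<in> I. \<exists>u \<in> universe (topology (\<P> i)). \<exists>\<beta>.
              local_iso (node_voc E) T [v] (topology (\<P> i)) [u] \<beta> \<and>
              R = pullback (gen (node_voc E) T {v}) \<beta> (sem (\<P> i) \<sigma> u))
      else {})"

definition global ::
  "('f, 'p, 'g, 'q, 'd, 'c, 'l) setting \<Rightarrow> ('t, 'f, 'p) fo_struct
     \<Rightarrow> ('c \<Rightarrow> 't \<Rightarrow> ('t, 'd) val_rel) \<Rightarrow> 't set \<Rightarrow> 'c \<times> 't \<Rightarrow> ('t, 'd) val_rel" where
  "global E T sm V c =
     {(\<nu>, \<nu>') \<in> valuations E V \<times> valuations E V.
        (restrict \<nu> (gen (node_voc E) T {snd c}), restrict \<nu>' (gen (node_voc E) T {snd c}))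
          \<in> sm (fst c) (snd c) \<and>
        (\<forall>x \<in> V - gen (node_voc E) T {snd c}. \<nu> x = \<nu>' x)}"

primrec global_word ::
  "('f, 'p, 'g, 'q, 'd, 'c, 'l) setting \<Rightarrow> ('t, 'f, 'p) fo_struct
     \<Rightarrow> ('c \<Rightarrow> 't \<Rightarrow> ('t, 'd) val_rel) \<Rightarrow> 't set \<Rightarrow> ('c \<times> 't) list \<Rightarrow> ('t, 'd) val_rel" where
  "global_word E T sm V [] = Id_on (valuations E V)"
| "global_word E T sm V (c # \<rho>) = global E T sm V c O global_word E T sm V \<rho>"

text \<open>An assertion is a formula \<open>\<phi>[x\<^sub>1, \<dots>, x\<^sub>m]\<close> with a tuple of nodes \<open>u\<^sub>1, \<dots>, u\<^sub>m\<close>; the variable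
  \<open>x\<^sub>j\<close> is \<open>Var (j - 1)\<close>.\<close>

definition is_assertion ::
  "('f, 'p, 'g, 'q, 'd, 'c, 'l) setting \<Rightarrow> ('t, 'f, 'p) fo_struct
     \<Rightarrow> ('g, 'q) fm \<times> 't list \<Rightarrow> bool" where
  "is_assertion E T A \<longleftrightarrow>
     wf_fm (data_voc E) (fst A) \<and> fv (fst A) \<subseteq> {..<length (snd A)} \<and>
     set (snd A) \<subseteq> universe T"

definition satisfies ::
  "('f, 'p, 'g, 'q, 'd, 'c, 'l) setting \<Rightarrow> ('t \<Rightarrow> 'd) \<Rightarrow> ('g, 'q) fm \<times> 't list \<Rightarrow> bool" where
  "satisfies E \<nu> A \<longleftrightarrow> sat (data E) (\<lambda>j. map \<nu> (snd A) ! j) (fst A)"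

definition valid_triple ::
  "('f, 'p, 'g, 'q, 'd, 'c, 'l) setting \<Rightarrow> ('t, 'f, 'p) fo_struct
     \<Rightarrow> ('c \<Rightarrow> 't \<Rightarrow> ('t, 'd) val_rel)
     \<Rightarrow> ('g, 'q) fm \<times> 't list \<Rightarrow> ('c \<times> 't) list \<Rightarrow> ('g, 'q) fm \<times> 't list \<Rightarrow> bool" where
  "valid_triple E T sm pre \<rho> post \<longleftrightarrow>
     (let V = gen (node_voc E) T (set (snd pre @ map snd \<rho> @ snd post))
      in \<forall>(\<nu>, \<nu>') \<in> global_word E T sm V \<rho>. satisfies E \<nu> pre \<longrightarrow> satisfies E \<nu>' post)"

lemma universe_gen_substruct [simp]:
  "universe (gen_substruct Voc S V) = gen Voc S V"
  "fint (gen_substruct Voc S V) = fint S"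
  "pint (gen_substruct Voc S V) = pint S"
  by (simp_all add: gen_substruct_def)

lemma structure_over_gen_substruct: "structure_over Voc (gen_substruct Voc S V)"
  by (auto simp: structure_over_def intro: gen.step)

lemma isomorphism_inv:
  assumes "isomorphism Voc A B h" "structure_over Voc A"
  shows "isomorphism Voc B A (inv_into (universe A) h)"
proof -
  let ?g = "inv_into (universe A) h"
  have inj: "inj_on h (universe A)" and im: "h ` universe A = universe B"
    using assms(1) by (auto simp: isomorphism_def embedding_def)
  have bij: "bij_betw ?g (universe B) (universe A)"
    using inj im by (intro bij_betw_inv_into) (simp add: bij_betw_def)
  have gl: "map ?g ys \<in> lists (universe A)" "map h (map ?g ys) = ys"
    if "ys \<in> lists (universe B)" for ys
  proof -
    show "map ?g ys \<in> lists (universe A)"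
      using that bij_betwE[OF bij] by auto
    show "map h (map ?g ys) = ys"
      unfolding map_map by (rule map_idI) (use that im in \<open>simp add: f_inv_into_f in_lists_conv_set\<close>)
  qed
  have F: "?g (fint B f ys) = fint A f (map ?g ys)"
    if "f \<in> funs Voc" "ys \<in> lists (universe B)" "length ys = farity Voc f" for f ys
  proof -
    have "h (fint A f (map ?g ys)) = fint B f (map h (map ?g ys))"
      using assms(1) that gl(1)[OF that(2)]
      unfolding isomorphism_def embedding_def by (metis length_map)
    moreover have "fint A f (map ?g ys) \<in> universe A"
      using assms(2) that gl(1)[OF that(2)] unfolding structure_over_def by (metis length_map)
    ultimately show ?thesis
      using inj gl(2)[OF that(2)] by (metis inv_into_f_f)
  qed
  have R: "pint B p ys \<longleftrightarrow> pint A p (map ?g ys)"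
    if "p \<in> preds Voc" "ys \<in> lists (universe B)" "length ys = parity Voc p" for p ys
    using assms(1) that gl[OF that(2)] unfolding isomorphism_def embedding_def
    by (metis length_map)
  show ?thesis
    using bij F R unfolding isomorphism_def embedding_def bij_betw_def by auto
qed

lemma isomorphism_comp:
  assumes "isomorphism Voc A B h" "isomorphism Voc B C k"
  shows "isomorphism Voc A C (k \<circ> h)"
proof -
  have h: "h ` universe A = universe B" and ih: "inj_on h (universe A)"
    and k: "k ` universe B = universe C" and ik: "inj_on k (universe B)"
    using assms by (auto simp: isomorphism_def embedding_def)
  have l: "map h xs \<in> lists (universe B)" if "xs \<in> lists (universe A)" for xs
    using that by (auto simp flip: h)
  have F: "(k \<circ> h) (fint A f xs) = fint C f (map (k \<circ> h) xs)"
    if "f \<in> funs Voc" "xs \<in> lists (universe A)" "length xs = farity Voc f" for f xs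
    using assms that l[OF that(2)] unfolding isomorphism_def embedding_def
    by (metis comp_apply length_map map_map)
  have R: "pint A p xs \<longleftrightarrow> pint C p (map (k \<circ> h) xs)"
    if "p \<in> preds Voc" "xs \<in> lists (universe A)" "length xs = parity Voc p" for p xs
    using assms that l[OF that(2)] unfolding isomorphism_def embedding_def
    by (metis length_map map_map)
  have im: "(k \<circ> h) ` universe A = universe C"
    using h k by (metis image_comp)
  moreover have "inj_on (k \<circ> h) (universe A)"
    using ih ik h by (simp add: comp_inj_on)
  ultimately show ?thesis
    using F R unfolding isomorphism_def embedding_def by (intro conjI ballI impI) auto
qed

lemma pullback_pullback:
  assumes "\<And>x. x \<in> A \<Longrightarrow> f x \<in> B" "\<And>x. x \<in> A \<Longrightarrow> g (f x) = h x"
  shows "pullback A f (pullback B g R) = pullback A h R"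
proof -
  have "compose A (compose B \<nu> g) f = compose A \<nu> h" for \<nu> :: "'c \<Rightarrow> 'd"
    using assms by (auto simp: compose_def restrict_def)
  then show ?thesis
    by (auto simp: pullback_def image_image map_prod_def split_beta)
qed

lemma ext_sem_unique:
  assumes P: "parameterized_program E I \<P>" and "\<sigma> \<in> commands E"
    and i: "i \<in> I" "u \<in> universe (topology (\<P> i))"
      "local_iso (node_voc E) T [v] (topology (\<P> i)) [u] \<beta>"
    and j: "j \<in> I" "w \<in> universe (topology (\<P> j))"
      "local_iso (node_voc E) T [v] (topology (\<P> j)) [w] \<gamma>"
  shows "pullback (gen (node_voc E) T {v}) \<beta> (sem (\<P> i) \<sigma> u) =
    pullback (gen (node_voc E) T {v}) \<gamma> (sem (\<P> j) \<sigma> w)"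
proof -
  let ?N = "gen (node_voc E) T {v}"
  let ?\<delta> = "\<gamma> \<circ> inv_into ?N \<beta>"
  have v: "v \<in> ?N" by (simp add: gen.base)
  have b: "inj_on \<beta> ?N" "\<beta> ` ?N = gen (node_voc E) (topology (\<P> i)) {u}" "\<beta> v = u"
    using i(3) by (auto simp: local_iso_def isomorphism_def embedding_def)
  have "isomorphism (node_voc E) (gen_substruct (node_voc E) (topology (\<P> i)) {u})
      (gen_substruct (node_voc E) T {v}) (inv_into ?N \<beta>)"
    using isomorphism_inv[OF _ structure_over_gen_substruct, of "node_voc E" T "{v}" _ \<beta>] i(3)
    by (simp add: local_iso_def)
  then have "isomorphism (node_voc E) (gen_substruct (node_voc E) (topology (\<P> i)) {u})
      (gen_substruct (node_voc E) (topology (\<P> j)) {w}) ?\<delta>"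
    by (rule isomorphism_comp) (use j(3) in \<open>simp add: local_iso_def\<close>)
  moreover have "?\<delta> u = w"
    using b v j(3) by (auto simp: local_iso_def)
  ultimately have "local_iso (node_voc E) (topology (\<P> i)) [u] (topology (\<P> j)) [w] ?\<delta>"
    by (simp add: local_iso_def)
  then have "sem (\<P> i) \<sigma> u =
      pullback (gen (node_voc E) (topology (\<P> i)) {u}) ?\<delta> (sem (\<P> j) \<sigma> w)"
    using P i j \<open>\<sigma> \<in> commands E\<close> unfolding parameterized_program_def by blast
  then show ?thesis
    using b by (auto intro!: pullback_pullback)
qed

lemma ext_sem_eq:
  assumes "parameterized_program E I \<P>" "\<sigma> \<in> commands E"
    and "i \<in> I" "u \<in> universe (topology (\<P> i))"
    and "local_iso (node_voc E) T [v] (topology (\<P> i)) [u] \<beta>"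
  shows "ext_sem E I \<P> T \<sigma> v = pullback (gen (node_voc E) T {v}) \<beta> (sem (\<P> i) \<sigma> u)"
proof -
  have "(THE R. \<exists>i \<in> I. \<exists>u \<in> universe (topology (\<P> i)). \<exists>\<beta>.
          local_iso (node_voc E) T [v] (topology (\<P> i)) [u] \<beta> \<and>
          R = pullback (gen (node_voc E) T {v}) \<beta> (sem (\<P> i) \<sigma> u)) =
        pullback (gen (node_voc E) T {v}) \<beta> (sem (\<P> i) \<sigma> u)"
  proof (rule the_equality, goal_cases)
    case 1
    then show ?case using assms(3-5) by blast
  next
    case (2 R)
    then obtain j w \<gamma> where "j \<in> I" "w \<in> universe (topology (\<P> j))"
      "local_iso (node_voc E) T [v] (topology (\<P> j)) [w] \<gamma>"
      and R: "R = pullback (gen (node_voc E) T {v}) \<gamma> (sem (\<P> j) \<sigma> w)"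
      by blast
    then show ?case
      unfolding R using assms by (intro ext_sem_unique)
  qed
  then show ?thesis
    unfolding ext_sem_def using assms(3-5) by (subst if_P) blast+
qed

end

theory Submission
  imports Defs
begin

text \<open>A local isomorphism \<open>\<beta>\<close> from \<open>us @ vs @ ws\<close> to \<open>us' @ vs' @ ws'\<close> restricts to
  a local isomorphism from each single node of its domain to the image of that node. The extended
  semantics is therefore natural along \<open>\<beta>\<close>, and precomposition with \<open>\<beta>\<close> turns every execution of
  the primed word into an execution of the original word. Since assertions only read values at the
  listed nodes, their truth is unchanged by this, and a counterexample to the primed triple would
  give one to the original.\<close>

lemma gen_mono_closed:
  assumes "W \<subseteq> gen Voc S V"
  shows "gen Voc S W \<subseteq> gen Voc S V"
proof
  fix x assume "x \<in> gen Voc S W"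
  then show "x \<in> gen Voc S V"
    by induction (use assms in \<open>auto intro: gen.step\<close>)
qed

text \<open>Since \<open>\<beta>\<close> commutes with the functions of the vocabulary, every stage
  of the generation from \<open>W\<close> corresponds to one from the image of \<open>W\<close>.
  This identifies the range of a restricted isomorphism.\<close>

lemma isomorphism_image_gen:
  assumes iso: "isomorphism Voc (gen_substruct Voc S V) (gen_substruct Voc S' V') \<beta>"
    and W: "W \<subseteq> gen Voc S V"
  shows "\<beta> ` gen Voc S W = gen Voc S' (\<beta> ` W)"
proof
  note WV = gen_mono_closed[OF W]
  have hom: "\<beta> (fint S f xs) = fint S' f (map \<beta> xs)"
    if "f \<in> funs Voc" "xs \<in> lists (gen Voc S W)" "length xs = farity Voc f" for f xs
    using iso that subsetD[OF lists_mono[OF WV]]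
    unfolding isomorphism_def embedding_def universe_gen_substruct by blast
  show "\<beta> ` gen Voc S W \<subseteq> gen Voc S' (\<beta> ` W)"
  proof (rule image_subsetI)
    fix x assume "x \<in> gen Voc S W"
    then show "\<beta> x \<in> gen Voc S' (\<beta> ` W)"
    proof induction
      case (step f xs)
      have "xs \<in> lists (gen Voc S W)" using step by auto
      with hom step have "\<beta> (fint S f xs) = fint S' f (map \<beta> xs)" by blast
      moreover have "fint S' f (map \<beta> xs) \<in> gen Voc S' (\<beta> ` W)"
        using step by (intro gen.step) auto
      ultimately show ?case by simp
    qed (simp add: gen.base)
  qed
  show "gen Voc S' (\<beta> ` W) \<subseteq> \<beta> ` gen Voc S W"
  proof
    fix y assume "y \<in> gen Voc S' (\<beta> ` W)"
    then show "y \<in> \<beta> ` gen Voc S W"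
    proof induction
      case (step f ys)
      then have "ys \<in> lists (\<beta> ` gen Voc S W)" by auto
      \<comment> \<open>Preimages of the arguments are chosen inside \<open>gen Voc S W\<close>;
        applying \<open>f\<close> to them yields the preimage of the new element.\<close>
      then obtain xs where xs: "xs \<in> lists (gen Voc S W)" "ys = map \<beta> xs"
        by (auto simp: lists_image)
      with hom step have "fint S' f ys = \<beta> (fint S f xs)" by simp
      moreover have "fint S f xs \<in> gen Voc S W"
        using xs step by (intro gen.step) auto
      ultimately show ?case by blast
    qed (auto intro: gen.base)
  qed
qed

text \<open>Injectivity and compatibility with functions and predicates are inherited by a smaller
  substructure; only the equation for the image needs an argument.\<close>

lemma local_iso_sublist:
  assumes iso: "local_iso Voc S as S' bs \<beta>" and xs: "set xs \<subseteq> gen Voc S (set as)"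
  shows "local_iso Voc S xs S' (map \<beta> xs) \<beta>"
proof -
  have iso': "isomorphism Voc (gen_substruct Voc S (set as)) (gen_substruct Voc S' (set bs)) \<beta>"
    using iso by (simp add: local_iso_def)
  have im: "\<beta> ` gen Voc S (set xs) = gen Voc S' (set (map \<beta> xs))"
    using isomorphism_image_gen[OF iso' xs] by simp
  note sub = gen_mono_closed[OF xs]
  show ?thesis
    using iso' im subsetD[OF lists_mono[OF sub]] inj_on_subset[OF _ sub]
    unfolding local_iso_def isomorphism_def embedding_def universe_gen_substruct
    by (intro conjI refl) blast+
qed

lemma local_iso_inv:
  assumes "local_iso Voc S as S' bs \<beta>"
  shows "local_iso Voc S' bs S as (inv_into (gen Voc S (set as)) \<beta>)"
proof -
  have "inj_on \<beta> (gen Voc S (set as))" "bs = map \<beta> as"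
    using assms by (auto simp: local_iso_def isomorphism_def embedding_def)
  then have "map (inv_into (gen Voc S (set as)) \<beta>) bs = as"
    by (auto intro!: map_idI simp: gen.base)
  then show ?thesis
    using assms isomorphism_inv[OF _ structure_over_gen_substruct, of Voc S "set as" _ \<beta>]
    by (simp add: local_iso_def)
qed

lemma local_iso_comp:
  assumes "local_iso Voc A as B bs \<beta>" "local_iso Voc B bs C cs \<gamma>"
  shows "local_iso Voc A as C cs (\<gamma> \<circ> \<beta>)"
  using assms isomorphism_comp unfolding local_iso_def by fastforce

text \<open>If \<open>\<gamma>\<close> matches \<open>v'\<close> with a node \<open>u\<close> of
  some \<open>\<P> i\<close>, then \<open>\<gamma> \<circ> \<beta>\<close> matches \<open>v\<close>
  with the same \<open>u\<close>. The extended semantics does not depend on the match chosen, so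
  both sides come from \<open>sem (\<P> i) \<sigma> u\<close>.\<close>

lemma ext_sem_local_iso:
  assumes P: "parameterized_program E I \<P>" and \<sigma>: "\<sigma> \<in> commands E"
    and iso: "local_iso (node_voc E) T [v] T [v'] \<beta>"
  shows "ext_sem E I \<P> T \<sigma> v = pullback (gen (node_voc E) T {v}) \<beta> (ext_sem E I \<P> T \<sigma> v')"
proof (cases "\<exists>i \<in> I. \<exists>u \<in> universe (topology (\<P> i)). \<exists>\<gamma>.
           local_iso (node_voc E) T [v'] (topology (\<P> i)) [u] \<gamma>")
  case True
  then obtain i u \<gamma> where i: "i \<in> I" "u \<in> universe (topology (\<P> i))"
    and \<gamma>: "local_iso (node_voc E) T [v'] (topology (\<P> i)) [u] \<gamma>" by blast
  have "\<beta> x \<in> gen (node_voc E) T {v'}" if "x \<in> gen (node_voc E) T {v}" for x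
    using iso that by (auto simp: local_iso_def isomorphism_def)
  then show ?thesis
    using ext_sem_eq[OF P \<sigma> i \<gamma>] ext_sem_eq[OF P \<sigma> i local_iso_comp[OF iso \<gamma>]]
    by (simp add: pullback_pullback)
next
  case False
  \<comment> \<open>A match for \<open>v\<close> would pass to \<open>v'\<close> along the inverse
    of \<open>\<beta>\<close>, so both semantics take the empty default.\<close>
  then have "\<not> (\<exists>i \<in> I. \<exists>u \<in> universe (topology (\<P> i)). \<exists>\<gamma>.
           local_iso (node_voc E) T [v] (topology (\<P> i)) [u] \<gamma>)"
    using local_iso_comp[OF local_iso_inv[OF iso]] by blast
  with False have "ext_sem E I \<P> T \<sigma> v = {}" "ext_sem E I \<P> T \<sigma> v' = {}"
    unfolding ext_sem_def by (simp_all only: if_False)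
  then show ?thesis by (simp add: pullback_def)
qed

lemma compose_PiE:
  assumes "\<nu> \<in> B \<rightarrow>\<^sub>E D" "\<beta> ` A \<subseteq> B"
  shows "compose A \<nu> \<beta> \<in> A \<rightarrow>\<^sub>E D"
  using assms by (auto simp: compose_def)

text \<open>On the neighbourhood of \<open>v\<close> this is naturality of the extended semantics;
  off it, injectivity of \<open>\<beta>\<close> carries the frame condition over.\<close>

lemma global_pullback:
  assumes P: "parameterized_program E I \<P>" and \<sigma>: "\<sigma> \<in> commands E"
    and iso: "local_iso (node_voc E) T as T bs \<beta>"
    and v: "v \<in> gen (node_voc E) T (set as)"
    and \<nu>: "(\<nu>, \<nu>') \<in> global E T (ext_sem E I \<P> T) (gen (node_voc E) T (set bs)) (\<sigma>, \<beta> v)"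
  shows "(compose (gen (node_voc E) T (set as)) \<nu> \<beta>, compose (gen (node_voc E) T (set as)) \<nu>' \<beta>)
    \<in> global E T (ext_sem E I \<P> T) (gen (node_voc E) T (set as)) (\<sigma>, v)"
proof -
  let ?A = "gen (node_voc E) T (set as)" and ?B = "gen (node_voc E) T (set bs)"
  let ?N = "gen (node_voc E) T {v}" and ?N' = "gen (node_voc E) T {\<beta> v}"
  have im: "\<beta> ` ?A = ?B" and inj: "inj_on \<beta> ?A"
    using iso by (auto simp: local_iso_def isomorphism_def embedding_def)
  have iso_v: "local_iso (node_voc E) T [v] T [\<beta> v] \<beta>"
    using local_iso_sublist[OF iso, of "[v]"] v by simp
  then have im_v: "\<beta> ` ?N = ?N'"
    by (auto simp: local_iso_def isomorphism_def)
  have sub: "?N \<subseteq> ?A" using gen_mono_closed[of "{v}"] v by blast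
  \<comment> \<open>Pulling back commutes with restricting because \<open>\<beta>\<close> maps
    \<open>?N\<close> into \<open>?N'\<close>; both sides are \<open>undefined\<close> off
    \<open>?N\<close>.\<close>
  have restr: "restrict (compose ?A \<mu> \<beta>) ?N = compose ?N (restrict \<mu> ?N') \<beta>" for \<mu>
    using sub im_v by (auto simp: compose_def restrict_def fun_eq_iff)
  have "(restrict \<nu> ?N', restrict \<nu>' ?N') \<in> ext_sem E I \<P> T \<sigma> (\<beta> v)"
    using \<nu> by (simp add: global_def)
  then have "(restrict (compose ?A \<nu> \<beta>) ?N, restrict (compose ?A \<nu>' \<beta>) ?N) \<in> ext_sem E I \<P> T \<sigma> v"
    unfolding ext_sem_local_iso[OF P \<sigma> iso_v] pullback_def restr by force
  moreover have "compose ?A \<nu> \<beta> x = compose ?A \<nu>' \<beta> x" if x: "x \<in> ?A - ?N" for x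
  proof -
    \<comment> \<open>As \<open>?N'\<close> is the image of \<open>?N\<close>, injectivity on
      \<open>?A\<close> keeps \<open>\<beta> x\<close> out of it.\<close>
    have "\<beta> x \<in> ?B - ?N'"
      using x im inj_on_image_mem_iff[OF inj _ sub] im_v by blast
    then show ?thesis using \<nu> x by (simp add: global_def compose_def)
  qed
  moreover have "compose ?A \<nu> \<beta> \<in> valuations E ?A" "compose ?A \<nu>' \<beta> \<in> valuations E ?A"
    using \<nu> compose_PiE[OF _ equalityD1[OF im]] unfolding global_def by blast+
  ultimately show ?thesis by (simp add: global_def)
qed

text \<open>All intermediate valuations live on the same generated set, so one
  \<open>\<beta>\<close> pulls back every step of the execution.\<close>

lemma global_word_pullback:
  assumes P: "parameterized_program E I \<P>"
    and iso: "local_iso (node_voc E) T as T bs \<beta>"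
    and "set \<rho> \<subseteq> commands E \<times> gen (node_voc E) T (set as)"
    and "(\<nu>, \<nu>') \<in> global_word E T (ext_sem E I \<P> T) (gen (node_voc E) T (set bs))
           (map (apsnd \<beta>) \<rho>)"
  shows "(compose (gen (node_voc E) T (set as)) \<nu> \<beta>, compose (gen (node_voc E) T (set as)) \<nu>' \<beta>)
    \<in> global_word E T (ext_sem E I \<P> T) (gen (node_voc E) T (set as)) \<rho>"
  using assms(3-)
proof (induction \<rho> arbitrary: \<nu>)
  case Nil
  have im: "\<beta> ` gen (node_voc E) T (set as) = gen (node_voc E) T (set bs)"
    using iso by (simp add: local_iso_def isomorphism_def)
  have "\<nu>' = \<nu>" and "\<nu> \<in> valuations E (gen (node_voc E) T (set bs))"
    using Nil unfolding list.map global_word.simps Id_on_iff by blast+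
  \<comment> \<open>The empty word relates only genuine valuations, so the pullback must be shown to
    be one, extensionality included.\<close>
  with compose_PiE[OF this(2) equalityD1[OF im]] show ?case
    by (simp add: Id_on_iff)
next
  case (Cons c \<rho>)
  obtain \<sigma> v where c: "c = (\<sigma>, v)" by fastforce
  with Cons.prems obtain \<mu>
    where "(\<nu>, \<mu>) \<in> global E T (ext_sem E I \<P> T) (gen (node_voc E) T (set bs)) (\<sigma>, \<beta> v)"
      and "(\<mu>, \<nu>') \<in> global_word E T (ext_sem E I \<P> T) (gen (node_voc E) T (set bs))
        (map (apsnd \<beta>) \<rho>)"
    by auto
  with Cons c show ?case
    using global_pullback[OF P _ iso, of \<sigma> v \<nu> \<mu>] by auto
qed

lemma satisfies_compose:
  assumes "set us \<subseteq> A"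
  shows "satisfies E (compose A \<nu> \<beta>) (\<phi>, us) \<longleftrightarrow> satisfies E \<nu> (\<phi>, map \<beta> us)"
proof -
  \<comment> \<open>Equality of the whole value lists makes the two environments agree at every
    index, even past the end of the list.\<close>
  have "map (compose A \<nu> \<beta>) us = map \<nu> (map \<beta> us)"
    using assms by (auto simp: compose_def)
  then show ?thesis by (simp only: satisfies_def fst_conv snd_conv)
qed

theorem theorem5p2:
  fixes E :: "('f, 'p, 'g, 'q, 'd, 'c, 'l) setting"
    and I :: "'i set"
    and \<P> :: "'i \<Rightarrow> ('n, 'f, 'p, 'd, 'c) program"
    and T :: "('t, 'f, 'p) fo_struct"
    and \<phi> \<psi> :: "('g, 'q) fm"
    and \<sigma>s :: "'c list"
    and us vs ws us' vs' ws' :: "'t list"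
  assumes "wf_setting E"
    and "parameterized_program E I \<P>"
    and "universal_structure E I \<P> T"
    and "is_assertion E T (\<phi>, us)"
    and "is_assertion E T (\<psi>, ws)"
    and "set \<sigma>s \<subseteq> commands E"
    and "length \<sigma>s = length vs"
    and "set vs \<subseteq> universe T"
    and "valid_triple E T (ext_sem E I \<P> T) (\<phi>, us) (zip \<sigma>s vs) (\<psi>, ws)"
    and "set us' \<subseteq> universe T" and "set vs' \<subseteq> universe T" and "set ws' \<subseteq> universe T"
    and "length us' = length us" and "length vs' = length vs" and "length ws' = length ws"
    and "locally_isomorphic (node_voc E) T (us @ vs @ ws) T (us' @ vs' @ ws')"
  shows "valid_triple E T (ext_sem E I \<P> T) (\<phi>, us') (zip \<sigma>s vs') (\<psi>, ws')"
proof -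
  let ?as = "us @ vs @ ws" and ?bs = "us' @ vs' @ ws'"
  let ?A = "gen (node_voc E) T (set ?as)" and ?B = "gen (node_voc E) T (set ?bs)"
  obtain \<beta> where iso: "local_iso (node_voc E) T ?as T ?bs \<beta>"
    using assms(16) by (auto simp: locally_isomorphic_def)
  \<comment> \<open>The equal lengths split the one equation between concatenated tuples into
    three.\<close>
  have maps: "us' = map \<beta> us" "vs' = map \<beta> vs" "ws' = map \<beta> ws"
    using iso assms(13-15) by (auto simp: local_iso_def)
  have A: "set us \<subseteq> ?A" "set vs \<subseteq> ?A" "set ws \<subseteq> ?A"
    by (auto intro: gen.base)
  \<comment> \<open>With equal lengths \<open>zip\<close> drops no node, so the sets
    \<open>V\<close> of the two triples are exactly \<open>?A\<close> and \<open>?B\<close>.\<close>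
  have nodes: "map snd (zip \<sigma>s vs) = vs" "map snd (zip \<sigma>s vs') = vs'"
    using assms(7,14) by simp_all
  have "satisfies E \<nu>' (\<psi>, ws')"
    if \<nu>: "(\<nu>, \<nu>') \<in> global_word E T (ext_sem E I \<P> T) ?B (zip \<sigma>s vs')"
      and pre: "satisfies E \<nu> (\<phi>, us')" for \<nu> \<nu>'
  proof -
    have word: "zip \<sigma>s vs' = map (apsnd \<beta>) (zip \<sigma>s vs)"
      by (simp add: maps zip_map2 apsnd_def map_prod_def)
    have "set (zip \<sigma>s vs) \<subseteq> commands E \<times> ?A"
      using assms(6) A(2) by (auto dest: set_zip_leftD set_zip_rightD)
    \<comment> \<open>The pulled-back pair is an execution of the original word on
      \<open>?A\<close>, to which the given triple applies.\<close>
    from global_word_pullback[OF assms(2) iso this \<nu>[unfolded word]]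
    have "satisfies E (compose ?A \<nu> \<beta>) (\<phi>, us) \<longrightarrow> satisfies E (compose ?A \<nu>' \<beta>) (\<psi>, ws)"
      using assms(9) unfolding valid_triple_def Let_def snd_conv nodes by blast
    with pre show ?thesis
      using A by (simp add: satisfies_compose maps)
  qed
  then show ?thesis
    unfolding valid_triple_def Let_def snd_conv nodes by blast
qed

end
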